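(* Let $(X_1,\unlhd_1,\wedge_1,\vee_1,0_1,1_1)$ and $(X_2,\unlhd_2,\wedge_2,\vee_2,0_2,1_2)$ be two bounded trellises, $S$ a pseudo-t-conorm on $X_2$ and $\rho:X_1\to X_2$ an isomorphism. Then the binary operation $S^\rho$ on $X_1$ defined by $S^\rho(x,y)=\rho^{-1}(S(\rho(x),\rho(y)))$ for all $x,y\in X_1$ is a pseudo-t-conorm on $X_1$.
   Context: A pseudo-order $\unlhd$ on a set $X$ is a reflexive and antisymmetric relation (not necessarily transitive); lower/upper bounds, infima and suprema are defined as for partially ordered sets (they are unique when they exist). A trellis $(X,\unlhd,\wedge,\vee)$ is a set with a pseudo-order in which any two elements $x,y$ have an infimum $x\wedge y$ and a supremum $x\vee y$. It is bounded, written $(X,\unlhd,\wedge,\vee,0,1)$, if it has elements $0,1$ with $0\unlhd x\unlhd 1$ for all $x\in X$. An isomorphism of trellises $\rho:X_1\to X_2$ is a bijection with $\rho(x\wedge_1 y)=\rho(x)\wedge_2\rho(y)$ and $\rho(x\vee_1 y)=\rho(x)\vee_2\rho(y)$ for all $x,y\in X_1$. An element $\alpha\in X$ is right-transitive if $\alpha\unlhd x\unlhd y$ implies $\alpha\unlhd y$; left-transitive if $x\unlhd y\unlhd\alpha$ implies $x\unlhd\alpha$; middle-transitive if $x\unlhd\alpha\unlhd y$ implies $x\unlhd y$ (for all $x,y\in X$); transitive if all three hold. A triple $(x,y,z)$ is $\wedge$-associative if $(x\wedge y)\wedge z=x\wedge(y\wedge z)$, and $\vee$-associative if $(x\vee y)\vee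 z=x\vee(y\vee z)$. An element is $\wedge$-associative (resp. $\vee$-associative) if every triple in $X^3$ containing it is $\wedge$-associative (resp. $\vee$-associative). A binary operation $F$ on $X$ is weakly-increasing if, whenever $x\unlhd y$ and at least one of $x,y$ is transitive, $F(x,z)\unlhd F(y,z)$ for all $z\in X$. It is weakly-associative if $F(x,F(y,z))=F(F(x,y),z)$ for all $x,y,z\in X$ such that at least one of $x,y,z$ is $\wedge$-associative or at least one of $x,y,z$ is $\vee$-associative. A pseudo-t-conorm on $X$ is a commutative, weakly-increasing, weakly-associative binary operation $S$ with $S(0,x)=x$ for all $x\in X$. *)

theory Defs
  imports Main
begin

text \<open>
  Trellises live on an explicit carrier set \<open>X\<close>; order relations and operations are total
  HOL functions of which only the values on \<open>X\<close> matter.  Transitivity of the order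
  is deliberately not assumed anywhere.
\<close>

definition pseudo_order_on :: "'a set \<Rightarrow> ('a \<Rightarrow> 'a \<Rightarrow> bool) \<Rightarrow> bool" where
  "pseudo_order_on X le \<longleftrightarrow> reflp_on X le \<and> antisymp_on X le"

definition is_lower_bound :: "'a set \<Rightarrow> ('a \<Rightarrow> 'a \<Rightarrow> bool) \<Rightarrow> 'a set \<Rightarrow> 'a \<Rightarrow> bool" where
  "is_lower_bound X le A m \<longleftrightarrow> m \<in> X \<and> (\<forall>a\<in>A. le m a)"

definition is_upper_bound :: "'a set \<Rightarrow> ('a \<Rightarrow> 'a \<Rightarrow> bool) \<Rightarrow> 'a set \<Rightarrow> 'a \<Rightarrow> bool" where
  "is_upper_bound X le A m \<longleftrightarrow> m \<in> X \<and> (\<forall>a\<in>A. le a m)"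

definition is_infimum :: "'a set \<Rightarrow> ('a \<Rightarrow> 'a \<Rightarrow> bool) \<Rightarrow> 'a set \<Rightarrow> 'a \<Rightarrow> bool" where
  "is_infimum X le A m \<longleftrightarrow>
     is_lower_bound X le A m \<and> (\<forall>n. is_lower_bound X le A n \<longrightarrow> le n m)"

definition is_supremum :: "'a set \<Rightarrow> ('a \<Rightarrow> 'a \<Rightarrow> bool) \<Rightarrow> 'a set \<Rightarrow> 'a \<Rightarrow> bool" where
  "is_supremum X le A m \<longleftrightarrow>
     is_upper_bound X le A m \<and> (\<forall>n. is_upper_bound X le A n \<longrightarrow> le m n)"

locale trellis =
  fixes X :: "'a set"
    and le :: "'a \<Rightarrow> 'a \<Rightarrow> bool" (infix "\<unlhd>" 50)
    and meet :: "'a \<Rightarrow> 'a \<Rightarrow> 'a" (infixl "\<sqinter>" 70)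
    and join :: "'a \<Rightarrow> 'a \<Rightarrow> 'a" (infixl "\<squnion>" 65)
  assumes pseudo_order: "pseudo_order_on X (\<unlhd>)"
    and meet_infimum: "\<And>x y. x \<in> X \<Longrightarrow> y \<in> X \<Longrightarrow> is_infimum X (\<unlhd>) {x, y} (x \<sqinter> y)"
    and join_supremum: "\<And>x y. x \<in> X \<Longrightarrow> y \<in> X \<Longrightarrow> is_supremum X (\<unlhd>) {x, y} (x \<squnion> y)"
begin

definition right_transitive :: "'a \<Rightarrow> bool" where
  "right_transitive a \<longleftrightarrow> (\<forall>x\<in>X. \<forall>y\<in>X. a \<unlhd> x \<and> x \<unlhd> y \<longrightarrow> a \<unlhd> y)"

definition left_transitive :: "'a \<Rightarrow> bool" where
  "left_transitive a \<longleftrightarrow> (\<forall>x\<in>X. \<forall>y\<in>X. x \<unlhd> y \<and> y \<unlhd> a \<longrightarrow> x \<unlhd> a)"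

definition middle_transitive :: "'a \<Rightarrow> bool" where
  "middle_transitive a \<longleftrightarrow> (\<forall>x\<in>X. \<forall>y\<in>X. x \<unlhd> a \<and> a \<unlhd> y \<longrightarrow> x \<unlhd> y)"

definition transitive_elem :: "'a \<Rightarrow> bool" where
  "transitive_elem a \<longleftrightarrow> right_transitive a \<and> left_transitive a \<and> middle_transitive a"

definition meet_assoc_triple :: "'a \<Rightarrow> 'a \<Rightarrow> 'a \<Rightarrow> bool" where
  "meet_assoc_triple x y z \<longleftrightarrow> (x \<sqinter> y) \<sqinter> z = x \<sqinter> (y \<sqinter> z)"

definition join_assoc_triple :: "'a \<Rightarrow> 'a \<Rightarrow> 'a \<Rightarrow> bool" where
  "join_assoc_triple x y z \<longleftrightarrow> (x \<squnion> y) \<squnion> z = x \<squnion> (y \<squnion> z)"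

definition meet_associative :: "'a \<Rightarrow> bool" where
  "meet_associative a \<longleftrightarrow>
     (\<forall>x\<in>X. \<forall>y\<in>X. \<forall>z\<in>X. a \<in> {x, y, z} \<longrightarrow> meet_assoc_triple x y z)"

definition join_associative :: "'a \<Rightarrow> bool" where
  "join_associative a \<longleftrightarrow>
     (\<forall>x\<in>X. \<forall>y\<in>X. \<forall>z\<in>X. a \<in> {x, y, z} \<longrightarrow> join_assoc_triple x y z)"

definition binary_operation :: "('a \<Rightarrow> 'a \<Rightarrow> 'a) \<Rightarrow> bool" where
  "binary_operation F \<longleftrightarrow> (\<forall>x\<in>X. \<forall>y\<in>X. F x y \<in> X)"

definition commutative_op :: "('a \<Rightarrow> 'a \<Rightarrow> 'a) \<Rightarrow> bool" where
  "commutative_op F \<longleftrightarrow> (\<forall>x\<in>X. \<forall>y\<in>X. F x y = F y x)"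

definition weakly_increasing :: "('a \<Rightarrow> 'a \<Rightarrow> 'a) \<Rightarrow> bool" where
  "weakly_increasing F \<longleftrightarrow>
     (\<forall>x\<in>X. \<forall>y\<in>X. x \<unlhd> y \<and> (transitive_elem x \<or> transitive_elem y) \<longrightarrow>
        (\<forall>z\<in>X. F x z \<unlhd> F y z))"

definition weakly_associative :: "('a \<Rightarrow> 'a \<Rightarrow> 'a) \<Rightarrow> bool" where
  "weakly_associative F \<longleftrightarrow>
     (\<forall>x\<in>X. \<forall>y\<in>X. \<forall>z\<in>X.
        (\<exists>a\<in>{x, y, z}. meet_associative a) \<or> (\<exists>a\<in>{x, y, z}. join_associative a) \<longrightarrow>
        F x (F y z) = F (F x y) z)"

end

locale bounded_trellis = trellis X le meet join
  for X :: "'a set"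
    and le :: "'a \<Rightarrow> 'a \<Rightarrow> bool" (infix "\<unlhd>" 50)
    and meet :: "'a \<Rightarrow> 'a \<Rightarrow> 'a" (infixl "\<sqinter>" 70)
    and join :: "'a \<Rightarrow> 'a \<Rightarrow> 'a" (infixl "\<squnion>" 65) +
  fixes zero :: 'a and one :: 'a
  assumes zero_in: "zero \<in> X"
    and one_in: "one \<in> X"
    and zero_le: "\<And>x. x \<in> X \<Longrightarrow> zero \<unlhd> x"
    and le_one: "\<And>x. x \<in> X \<Longrightarrow> x \<unlhd> one"
begin

definition pseudo_t_conorm :: "('a \<Rightarrow> 'a \<Rightarrow> 'a) \<Rightarrow> bool" where
  "pseudo_t_conorm S \<longleftrightarrow>
     binary_operation S \<and> commutative_op S \<and> weakly_increasing S \<and> weakly_associative S \<and>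
     (\<forall>x\<in>X. S zero x = x)"

end

definition trellis_iso ::
  "'a set \<Rightarrow> ('a \<Rightarrow> 'a \<Rightarrow> 'a) \<Rightarrow> ('a \<Rightarrow> 'a \<Rightarrow> 'a) \<Rightarrow>
   'b set \<Rightarrow> ('b \<Rightarrow> 'b \<Rightarrow> 'b) \<Rightarrow> ('b \<Rightarrow> 'b \<Rightarrow> 'b) \<Rightarrow> ('a \<Rightarrow> 'b) \<Rightarrow> bool" where
  "trellis_iso X1 meet1 join1 X2 meet2 join2 \<rho> \<longleftrightarrow>
     bij_betw \<rho> X1 X2 \<and>
     (\<forall>x\<in>X1. \<forall>y\<in>X1. \<rho> (meet1 x y) = meet2 (\<rho> x) (\<rho> y)) \<and>
     (\<forall>x\<in>X1. \<forall>y\<in>X1. \<rho> (join1 x y) = join2 (\<rho> x) (\<rho> y))"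

end

theory Submission
  imports Defs
begin

text \<open>
  Every notion entering the definition of a pseudo-t-conorm is formulated in terms of the order,
  the two lattice operations and the bottom element, so it suffices that an isomorphism carries
  each of these to its counterpart.  The operations are preserved by assumption.  The order is
  recovered from the meet, since \<open>x \<unlhd> y\<close> is equivalent to \<open>x \<sqinter> y = x\<close>
  even without transitivity (\<open>le_iff_meet\<close>); hence the order is preserved and reflected
  (\<open>image_le_iff\<close>), and with it the bottom element (\<open>image_zero\<close>).

  Both weak axioms have a hypothesis asking some argument to be transitive or associative.  To
  use the axioms for \<open>S\<close> these hypotheses have to be moved from \<open>X1\<close> to \<open>X2\<close>, where
  they quantify over all of \<open>X2\<close>; surjectivity of \<open>\<rho>\<close> reduces them to images of elements
  of \<open>X1\<close>.  The conclusions are then pulled back through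
  \<open>\<rho> (pullback S x y) = S (\<rho> x) (\<rho> y)\<close>: equations by injectivity of \<open>\<rho>\<close>, inequalities by
  reflection of the order.
\<close>

context trellis
begin

text \<open>
  Reflexivity makes \<open>x\<close> a lower bound of \<open>{x, y}\<close> as soon as \<open>x \<unlhd> y\<close>, and
  antisymmetry then identifies it with the greatest one.
\<close>

lemma le_iff_meet:
  assumes "x \<in> X" "y \<in> X"
  shows "x \<unlhd> y \<longleftrightarrow> x \<sqinter> y = x"
proof -
  have inf: "x \<sqinter> y \<in> X" "x \<sqinter> y \<unlhd> x" "x \<sqinter> y \<unlhd> y"
    and greatest: "\<And>n. n \<in> X \<Longrightarrow> n \<unlhd> x \<Longrightarrow> n \<unlhd> y \<Longrightarrow> n \<unlhd> x \<sqinter> y"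
    using meet_infimum[OF assms] by (auto simp: is_infimum_def is_lower_bound_def)
  have refl: "x \<unlhd> x"
    using pseudo_order assms(1) by (auto simp: pseudo_order_on_def reflp_on_def)
  have antisym: "x \<sqinter> y = x" if "x \<unlhd> x \<sqinter> y"
    using pseudo_order inf assms(1) that
    by (auto simp: pseudo_order_on_def antisymp_on_def)
  show ?thesis
    using inf(3) greatest[OF assms(1) refl] antisym by auto
qed

lemma meet_in: "x \<in> X \<Longrightarrow> y \<in> X \<Longrightarrow> x \<sqinter> y \<in> X"
  using meet_infimum by (auto simp: is_infimum_def is_lower_bound_def)

lemma join_in: "x \<in> X \<Longrightarrow> y \<in> X \<Longrightarrow> x \<squnion> y \<in> X"
  using join_supremum by (auto simp: is_supremum_def is_upper_bound_def)

end

locale trellis_isomorphism =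
  A: trellis X1 le1 meet1 join1 + B: trellis X2 le2 meet2 join2
  for X1 :: "'a set" and le1 meet1 join1
    and X2 :: "'b set" and le2 meet2 join2 +
  fixes \<rho> :: "'a \<Rightarrow> 'b"
  assumes iso: "trellis_iso X1 meet1 join1 X2 meet2 join2 \<rho>"
begin

lemma bij: "bij_betw \<rho> X1 X2"
  using iso by (simp add: trellis_iso_def)

lemma image_eq_iff: "x \<in> X1 \<Longrightarrow> y \<in> X1 \<Longrightarrow> \<rho> x = \<rho> y \<longleftrightarrow> x = y"
  using bij by (auto simp: bij_betw_def inj_on_eq_iff)

lemma carrier_eq_image: "X2 = \<rho> ` X1"
  using bij by (simp add: bij_betw_def)

lemma image_in: "x \<in> X1 \<Longrightarrow> \<rho> x \<in> X2"
  by (simp add: carrier_eq_image)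

lemma image_meet: "x \<in> X1 \<Longrightarrow> y \<in> X1 \<Longrightarrow> meet2 (\<rho> x) (\<rho> y) = \<rho> (meet1 x y)"
  using iso by (simp add: trellis_iso_def)

lemma image_join: "x \<in> X1 \<Longrightarrow> y \<in> X1 \<Longrightarrow> join2 (\<rho> x) (\<rho> y) = \<rho> (join1 x y)"
  using iso by (simp add: trellis_iso_def)

lemma image_le_iff: "x \<in> X1 \<Longrightarrow> y \<in> X1 \<Longrightarrow> le2 (\<rho> x) (\<rho> y) \<longleftrightarrow> le1 x y"
  by (simp add: A.le_iff_meet B.le_iff_meet image_in image_meet image_eq_iff A.meet_in)

text \<open>
  Once \<open>X2\<close> is written as \<open>\<rho> ` X1\<close>, the quantifiers over \<open>X2\<close> run over images of
  elements of \<open>X1\<close>, and preservation and reflection of the order turn the claim into the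
  assumption.  The two lemmas on associative elements follow the same pattern, with the lattice
  operations in place of the order.
\<close>

lemma image_transitive_elem:
  assumes "a \<in> X1" "A.transitive_elem a"
  shows "B.transitive_elem (\<rho> a)"
proof -
  have right: "A.right_transitive a" and left: "A.left_transitive a"
    and middle: "A.middle_transitive a"
    using assms(2) by (simp_all add: A.transitive_elem_def)
  have "B.right_transitive (\<rho> a)"
    unfolding B.right_transitive_def
  proof (intro ballI impI)
    fix x' y'
    assume "x' \<in> X2" "y' \<in> X2" and le: "le2 (\<rho> a) x' \<and> le2 x' y'"
    then obtain x y where X: "x \<in> X1" "y \<in> X1" and eqs: "x' = \<rho> x" "y' = \<rho> y"
      by (auto simp: carrier_eq_image)
    have "le1 a x" "le1 x y"
      using le X assms(1) by (simp_all add: eqs image_le_iff)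
    then have "le1 a y"
      using right X unfolding A.right_transitive_def by blast
    then show "le2 (\<rho> a) y'"
      using X assms(1) by (simp add: eqs image_le_iff)
  qed
  moreover have "B.left_transitive (\<rho> a)"
    unfolding B.left_transitive_def
  proof (intro ballI impI)
    fix x' y'
    assume "x' \<in> X2" "y' \<in> X2" and le: "le2 x' y' \<and> le2 y' (\<rho> a)"
    then obtain x y where X: "x \<in> X1" "y \<in> X1" and eqs: "x' = \<rho> x" "y' = \<rho> y"
      by (auto simp: carrier_eq_image)
    have "le1 x y" "le1 y a"
      using le X assms(1) by (simp_all add: eqs image_le_iff)
    then have "le1 x a"
      using left X unfolding A.left_transitive_def by blast
    then show "le2 x' (\<rho> a)"
      using X assms(1) by (simp add: eqs image_le_iff)
  qed
  moreover have "B.middle_transitive (\<rho> a)"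
    unfolding B.middle_transitive_def
  proof (intro ballI impI)
    fix x' y'
    assume "x' \<in> X2" "y' \<in> X2" and le: "le2 x' (\<rho> a) \<and> le2 (\<rho> a) y'"
    then obtain x y where X: "x \<in> X1" "y \<in> X1" and eqs: "x' = \<rho> x" "y' = \<rho> y"
      by (auto simp: carrier_eq_image)
    have "le1 x a" "le1 a y"
      using le X assms(1) by (simp_all add: eqs image_le_iff)
    then have "le1 x y"
      using middle X unfolding A.middle_transitive_def by blast
    then show "le2 x' y'"
      using X assms(1) by (simp add: eqs image_le_iff)
  qed
  ultimately show ?thesis
    by (simp add: B.transitive_elem_def)
qed

lemma image_meet_associative:
  assumes "a \<in> X1" "A.meet_associative a"
  shows "B.meet_associative (\<rho> a)"
  unfolding B.meet_associative_def
proof (intro ballI impI)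
  fix x' y' z'
  assume "x' \<in> X2" "y' \<in> X2" "z' \<in> X2" and a: "\<rho> a \<in> {x', y', z'}"
  then obtain x y z where X: "x \<in> X1" "y \<in> X1" "z \<in> X1"
    and eqs: "x' = \<rho> x" "y' = \<rho> y" "z' = \<rho> z"
    by (auto simp: carrier_eq_image)
  have "a \<in> {x, y, z}"
    using a X assms(1) by (simp add: eqs image_eq_iff)
  then have "meet1 (meet1 x y) z = meet1 x (meet1 y z)"
    using assms(2) X unfolding A.meet_associative_def A.meet_assoc_triple_def by blast
  then show "B.meet_assoc_triple x' y' z'"
    using X by (simp add: B.meet_assoc_triple_def eqs image_meet A.meet_in)
qed

lemma image_join_associative:
  assumes "a \<in> X1" "A.join_associative a"
  shows "B.join_associative (\<rho> a)"
  unfolding B.join_associative_def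
proof (intro ballI impI)
  fix x' y' z'
  assume "x' \<in> X2" "y' \<in> X2" "z' \<in> X2" and a: "\<rho> a \<in> {x', y', z'}"
  then obtain x y z where X: "x \<in> X1" "y \<in> X1" "z \<in> X1"
    and eqs: "x' = \<rho> x" "y' = \<rho> y" "z' = \<rho> z"
    by (auto simp: carrier_eq_image)
  have "a \<in> {x, y, z}"
    using a X assms(1) by (simp add: eqs image_eq_iff)
  then have "join1 (join1 x y) z = join1 x (join1 y z)"
    using assms(2) X unfolding A.join_associative_def A.join_assoc_triple_def by blast
  then show "B.join_assoc_triple x' y' z'"
    using X by (simp add: B.join_assoc_triple_def eqs image_join A.join_in)
qed

definition pullback :: "('b \<Rightarrow> 'b \<Rightarrow> 'b) \<Rightarrow> 'a \<Rightarrow> 'a \<Rightarrow> 'a" where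
  "pullback S = (\<lambda>x y. inv_into X1 \<rho> (S (\<rho> x) (\<rho> y)))"

context
  fixes S :: "'b \<Rightarrow> 'b \<Rightarrow> 'b"
  assumes closed: "B.binary_operation S"
begin

lemma value_in_image: "x \<in> X1 \<Longrightarrow> y \<in> X1 \<Longrightarrow> S (\<rho> x) (\<rho> y) \<in> \<rho> ` X1"
  using closed image_in by (simp add: B.binary_operation_def flip: carrier_eq_image)

lemma pullback_in: "x \<in> X1 \<Longrightarrow> y \<in> X1 \<Longrightarrow> pullback S x y \<in> X1"
  by (simp add: pullback_def inv_into_into value_in_image)

lemma image_pullback: "x \<in> X1 \<Longrightarrow> y \<in> X1 \<Longrightarrow> \<rho> (pullback S x y) = S (\<rho> x) (\<rho> y)"
  by (simp add: pullback_def f_inv_into_f value_in_image)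

lemma pullback_binary_operation: "A.binary_operation (pullback S)"
  by (simp add: A.binary_operation_def pullback_in)

lemma pullback_commutative:
  assumes "B.commutative_op S"
  shows "A.commutative_op (pullback S)"
  using assms image_in by (simp add: A.commutative_op_def B.commutative_op_def pullback_def)

lemma pullback_weakly_increasing:
  assumes "B.weakly_increasing S"
  shows "A.weakly_increasing (pullback S)"
  unfolding A.weakly_increasing_def
proof (intro ballI impI)
  fix x y z
  assume X: "x \<in> X1" "y \<in> X1" "z \<in> X1"
    and xy: "le1 x y \<and> (A.transitive_elem x \<or> A.transitive_elem y)"
  have "le2 (\<rho> x) (\<rho> y)"
    using X xy by (simp add: image_le_iff)
  moreover have "B.transitive_elem (\<rho> x) \<or> B.transitive_elem (\<rho> y)"
    using X xy image_transitive_elem by blast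
  ultimately have "le2 (S (\<rho> x) (\<rho> z)) (S (\<rho> y) (\<rho> z))"
    using assms X image_in unfolding B.weakly_increasing_def by blast
  then have "le2 (\<rho> (pullback S x z)) (\<rho> (pullback S y z))"
    using X by (simp add: image_pullback)
  then show "le1 (pullback S x z) (pullback S y z)"
    using X by (simp add: image_le_iff pullback_in)
qed

lemma pullback_weakly_associative:
  assumes "B.weakly_associative S"
  shows "A.weakly_associative (pullback S)"
  unfolding A.weakly_associative_def
proof (intro ballI impI)
  fix x y z
  assume X: "x \<in> X1" "y \<in> X1" "z \<in> X1"
    and assoc: "(\<exists>a\<in>{x, y, z}. A.meet_associative a) \<or> (\<exists>a\<in>{x, y, z}. A.join_associative a)"
  have "(\<exists>b\<in>{\<rho> x, \<rho> y, \<rho> z}. B.meet_associative b) \<or>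
        (\<exists>b\<in>{\<rho> x, \<rho> y, \<rho> z}. B.join_associative b)"
    using X assoc image_meet_associative image_join_associative by blast
  then have "S (\<rho> x) (S (\<rho> y) (\<rho> z)) = S (S (\<rho> x) (\<rho> y)) (\<rho> z)"
    using assms X image_in unfolding B.weakly_associative_def by blast
  then have "\<rho> (pullback S x (pullback S y z)) = \<rho> (pullback S (pullback S x y) z)"
    using X by (simp add: image_pullback pullback_in)
  then show "pullback S x (pullback S y z) = pullback S (pullback S x y) z"
    using X by (simp add: image_eq_iff pullback_in)
qed

end

lemma pullback_left_neutral:
  assumes "x \<in> X1" "S (\<rho> e) (\<rho> x) = \<rho> x"
  shows "pullback S e x = x"
  using assms bij by (simp add: pullback_def bij_betw_inv_into_left)

end

locale bounded_trellis_isomorphism =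
  A: bounded_trellis X1 le1 meet1 join1 zero1 one1 +
  B: bounded_trellis X2 le2 meet2 join2 zero2 one2 +
  trellis_isomorphism X1 le1 meet1 join1 X2 le2 meet2 join2 \<rho>
  for X1 :: "'a set" and le1 meet1 join1 zero1 one1
    and X2 :: "'b set" and le2 meet2 join2 zero2 one2
    and \<rho> :: "'a \<Rightarrow> 'b"
begin

text \<open>
  The image of the bottom lies below the image of every element, hence below \<open>zero2\<close> by
  surjectivity; antisymmetry of the order of \<open>X2\<close> gives equality.
\<close>

lemma image_zero: "\<rho> zero1 = zero2"
proof -
  obtain z where z: "z \<in> X1" "zero2 = \<rho> z"
    using B.zero_in by (auto simp: carrier_eq_image)
  have "le2 (\<rho> zero1) zero2"
    using z A.zero_in A.zero_le by (simp add: image_le_iff)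
  moreover have "le2 zero2 (\<rho> zero1)"
    using A.zero_in by (intro B.zero_le image_in)
  ultimately show ?thesis
    using B.pseudo_order B.zero_in image_in[OF A.zero_in]
    by (auto simp: pseudo_order_on_def antisymp_on_def)
qed

lemma pullback_pseudo_t_conorm:
  assumes "B.pseudo_t_conorm S"
  shows "A.pseudo_t_conorm (pullback S)"
  using assms image_in
  unfolding A.pseudo_t_conorm_def B.pseudo_t_conorm_def
  by (simp add: pullback_binary_operation pullback_commutative pullback_weakly_increasing
      pullback_weakly_associative pullback_left_neutral image_zero)

end

theorem proposition6p4:
  fixes X1 :: "'a set" and le1 :: "'a \<Rightarrow> 'a \<Rightarrow> bool"
    and meet1 join1 :: "'a \<Rightarrow> 'a \<Rightarrow> 'a" and zero1 one1 :: 'a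
    and X2 :: "'b set" and le2 :: "'b \<Rightarrow> 'b \<Rightarrow> bool"
    and meet2 join2 :: "'b \<Rightarrow> 'b \<Rightarrow> 'b" and zero2 one2 :: 'b
    and S :: "'b \<Rightarrow> 'b \<Rightarrow> 'b" and \<rho> :: "'a \<Rightarrow> 'b"
  assumes "bounded_trellis X1 le1 meet1 join1 zero1 one1"
    and "bounded_trellis X2 le2 meet2 join2 zero2 one2"
    and "bounded_trellis.pseudo_t_conorm X2 le2 meet2 join2 zero2 S"
    and "trellis_iso X1 meet1 join1 X2 meet2 join2 \<rho>"
  shows "bounded_trellis.pseudo_t_conorm X1 le1 meet1 join1 zero1
           (\<lambda>x y. inv_into X1 \<rho> (S (\<rho> x) (\<rho> y)))"
proof -
  interpret bounded_trellis_isomorphism X1 le1 meet1 join1 zero1 one1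
      X2 le2 meet2 join2 zero2 one2 \<rho>
    using assms
    by (simp add: bounded_trellis_isomorphism_def trellis_isomorphism_def
        trellis_isomorphism_axioms_def bounded_trellis_def)
  show ?thesis
    using pullback_pseudo_t_conorm[OF assms(3)] by (simp add: pullback_def)
qed

end
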